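(* Let $M$ be a screen generic lightlike submanifold of a locally bronze semi-Riemannian manifold $(\bar M,\bar g,\bar J)$ with an $(l,m)$-type connection $\bar\Omega$. Then the distribution $B=B_o\perp\mathrm{Rad}\,TM$ defines a totally geodesic foliation in $\bar M$ (with respect to $\bar\Omega$) if and only if $M$ is $B$-geodesic and $B$ is parallel with respect to the induced connection $\Omega$ on $M$.
   Context: Bronze manifold: a semi-Riemannian manifold $(\bar M,\bar g)$ (of constant index $q$, $1\le q\le \dim\bar M-1$) with a $(1,1)$-tensor field $\bar J$ satisfying $\bar J^2=3\bar J+I$ and $\bar g(\bar JX,Y)=\bar g(X,\bar JY)$; it is locally bronze if $\bar\nabla\bar J=0$ for the Levi-Civita connection $\bar\nabla$. Lightlike submanifold: $M\subset\bar M$ such that $\mathrm{Rad}\,TM=TM\cap TM^\perp$ is a distribution of constant rank $r>0$; $g$ is the induced metric. One fixes $S(TM)$, $S(TM^\perp)$ with $TM=\mathrm{Rad}\,TM\perp S(TM)$, $TM^\perp=\mathrm{Rad}\,TM\perp S(TM^\perp)$, and a lightlike transversal bundle $\mathrm{ltr}(TM)$ (locally spanned by $N_1,\dots,N_r$ in $S(TM^\perp)^\perp$, orthogonal to $S(TM)$, with $\bar g(N_i,\xi_j)=\delta_{ij}$, $\bar g(N_i,N_j)=0$ for a local basis $\xi_1,\dots,\xi_r$ of $\mathrm{Rad}\,TM$). Then $T\bar M|_M=TM\oplus \mathrm{ltr}(TM)\oplus S(TM^\perp)$. For $X\in\Gamma(TM)$ write $\bar JX=fX+wX$ with $fX$ tangential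 and $wX$ transversal. Screen generic: $M$ is screen generic if $\bar J(\mathrm{Rad}\,TM)=\mathrm{Rad}\,TM$ and $B_o=\bar J(S(TM))\cap S(TM)$ is a non-degenerate distribution; $B'$ denotes the complementary (orthogonal) non-degenerate distribution in $S(TM)$, so $S(TM)=B_o\oplus B'$, with (when $B'\neq\{0\}$) $\bar J(B')\not\subseteq S(TM)$ and $\bar J(B')\not\subseteq S(TM^\perp)$, and $fY\in\Gamma(B')$, $wY\in\Gamma(S(TM^\perp))$ for $Y\in\Gamma(B')$. The distribution $B=B_o\perp\mathrm{Rad}\,TM$ is $\bar J$-invariant. $(l,m)$-type connection: let $l,m$ be smooth functions on $\bar M$, $(l,m)\ne(0,0)$, $\eta$ a smooth unit spacelike vector field on $\bar M$, $\theta(X)=\bar g(X,\eta)$. Then $\bar\Omega_XY=\bar\nabla_XY+\theta(Y)\{lX+m\bar JX\}$. For $X,Y\in\Gamma(TM)$, $\bar\Omega_XY=\Omega_XY+\bar h^{l}(X,Y)+\bar h^{s}(X,Y)$ with components in $TM$, $\mathrm{ltr}(TM)$, $S(TM^\perp)$ respectively. Definitions: $B$ defines a totally geodesic foliation in $\bar M$ if $\bar\Omega_XY\in\Gamma(B)$ for all $X,Y\in\Gamma(B)$. $M$ is $B$-geodesic (with the $(l,m)$-type connection) if $\bar h^{l}(X,Y)=\bar h^{s}(X,Y)=0$ for all $X,Y\in\Gamma(B)$. $B$ is parallel with respect to $\Omega$ if $\Omega_XY\in\Gamma(B)$ for all $X,Y\in\Gamma(B)$. *)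

theory Defs
  imports "HOL-Analysis.Analysis" "HOL-Library.Set_Algebras"
begin

section \<open>Smooth manifolds\<close>

text \<open>The next two notions are meant for open sets S.\<close>

fun Ck_on :: "nat \<Rightarrow> ('e::euclidean_space \<Rightarrow> 'f::real_normed_vector) \<Rightarrow> 'e set \<Rightarrow> bool" where
  "Ck_on 0 f S \<longleftrightarrow> continuous_on S f"
| "Ck_on (Suc k) f S \<longleftrightarrow>
     f differentiable_on S \<and> (\<forall>v. Ck_on k (\<lambda>x. frechet_derivative f (at x) v) S)"

definition smooth_on :: "('e::euclidean_space \<Rightarrow> 'f::real_normed_vector) \<Rightarrow> 'e set \<Rightarrow> bool" where
  "smooth_on f S \<longleftrightarrow> (\<forall>k. Ck_on k f S)"

text \<open>A manifold is a whole (Hausdorff, second countable) type of points together with an atlas;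
  a chart is a pair of a domain and a coordinate map whose values outside the domain
  are irrelevant. The dimension is that of the model space.\<close>

type_synonym ('a, 'e) atlas = "('a set \<times> ('a \<Rightarrow> 'e)) set"

definition smooth_manifold ::
  "('a::{t2_space,second_countable_topology}, 'e::euclidean_space) atlas \<Rightarrow> bool" where
  "smooth_manifold A \<longleftrightarrow>
     (\<Union>(U, \<phi>)\<in>A. U) = UNIV \<and>
     (\<forall>(U, \<phi>)\<in>A. open U \<and> open (\<phi> ` U) \<and> homeomorphism U (\<phi> ` U) \<phi> (inv_into U \<phi>)) \<and>
     (\<forall>(U, \<phi>)\<in>A. \<forall>(V, \<psi>)\<in>A. smooth_on (\<psi> \<circ> inv_into U \<phi>) (\<phi> ` (U \<inter> V)))"

definition smooth_fun_on ::
  "('a::{t2_space,second_countable_topology}, 'e::euclidean_space) atlas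
     \<Rightarrow> 'a set \<Rightarrow> ('a \<Rightarrow> real) \<Rightarrow> bool" where
  "smooth_fun_on A W f \<longleftrightarrow> (\<forall>(U, \<phi>)\<in>A. smooth_on (f \<circ> inv_into U \<phi>) (\<phi> ` (U \<inter> W)))"

abbreviation smooth_fun ::
  "('a::{t2_space,second_countable_topology}, 'e::euclidean_space) atlas
     \<Rightarrow> ('a \<Rightarrow> real) \<Rightarrow> bool" where
  "smooth_fun A \<equiv> smooth_fun_on A UNIV"

definition smooth_map ::
  "('b::{t2_space,second_countable_topology}, 'd::euclidean_space) atlas \<Rightarrow>
   ('a::{t2_space,second_countable_topology}, 'e::euclidean_space) atlas \<Rightarrow> ('b \<Rightarrow> 'a) \<Rightarrow> bool" where
  "smooth_map C A \<iota> \<longleftrightarrow> continuous_on UNIV \<iota> \<and>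
     (\<forall>(V, \<psi>)\<in>C. \<forall>(U, \<phi>)\<in>A. smooth_on (\<phi> \<circ> \<iota> \<circ> inv_into V \<psi>) (\<psi> ` (V \<inter> \<iota> -` U)))"

text \<open>The tangent space at every point p is the model space: the vector v stands for the class of
  tangent vectors whose components in a preferred chart around p are v. Thus a vector field is a
  map from points to the model space, which need not be continuous as such a map because
  the preferred chart varies with p. Everything below uses tangent vectors only through their action
  on functions (\<open>dir_deriv\<close>) and through differentials (\<open>pushforward\<close>), so no notion depends on
  the preferred charts.\<close>

definition chart_at :: "('a, 'e) atlas \<Rightarrow> 'a \<Rightarrow> 'a set \<times> ('a \<Rightarrow> 'e)" where
  "chart_at A p = (SOME c. c \<in> A \<and> p \<in> fst c)"

definition coord_at :: "('a, 'e) atlas \<Rightarrow> 'a \<Rightarrow> 'a \<Rightarrow> 'e" where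
  "coord_at A p = snd (chart_at A p)"

definition param_at :: "('a, 'e) atlas \<Rightarrow> 'a \<Rightarrow> 'e \<Rightarrow> 'a" where
  "param_at A p = inv_into (fst (chart_at A p)) (snd (chart_at A p))"

definition dir_deriv :: "('a, 'e::euclidean_space) atlas \<Rightarrow> 'a \<Rightarrow> 'e \<Rightarrow> ('a \<Rightarrow> real) \<Rightarrow> real" where
  "dir_deriv A p v f = frechet_derivative (f \<circ> param_at A p) (at (coord_at A p p)) v"

definition pushforward ::
  "('b, 'd::euclidean_space) atlas \<Rightarrow> ('a, 'e::euclidean_space) atlas \<Rightarrow> ('b \<Rightarrow> 'a) \<Rightarrow> 'b \<Rightarrow> 'd \<Rightarrow> 'e" where
  "pushforward C A \<iota> p =
     frechet_derivative (coord_at A (\<iota> p) \<circ> \<iota> \<circ> param_at C p) (at (coord_at C p p))"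

definition vector_field ::
  "('a::{t2_space,second_countable_topology}, 'e::euclidean_space) atlas \<Rightarrow> ('a \<Rightarrow> 'e) \<Rightarrow> bool" where
  "vector_field A X \<longleftrightarrow> (\<forall>f. smooth_fun A f \<longrightarrow> smooth_fun A (\<lambda>p. dir_deriv A p (X p) f))"


section \<open>Semi-Riemannian and bronze manifolds\<close>

definition nondegenerate_on :: "('e::real_vector \<Rightarrow> 'e \<Rightarrow> real) \<Rightarrow> 'e set \<Rightarrow> bool" where
  "nondegenerate_on b W \<longleftrightarrow> (\<forall>v\<in>W. (\<forall>w\<in>W. b v w = 0) \<longrightarrow> v = 0)"

definition negative_definite_on :: "('e::real_vector \<Rightarrow> 'e \<Rightarrow> real) \<Rightarrow> 'e set \<Rightarrow> bool" where
  "negative_definite_on b W \<longleftrightarrow> (\<forall>v\<in>W. v \<noteq> 0 \<longrightarrow> b v v < 0)"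

definition has_index :: "('e::euclidean_space \<Rightarrow> 'e \<Rightarrow> real) \<Rightarrow> nat \<Rightarrow> bool" where
  "has_index b q \<longleftrightarrow>
     (\<exists>W. subspace W \<and> negative_definite_on b W \<and> dim W = q) \<and>
     (\<forall>W. subspace W \<and> negative_definite_on b W \<longrightarrow> dim W \<le> q)"

definition semi_riemannian ::
  "('a::{t2_space,second_countable_topology}, 'e::euclidean_space) atlas \<Rightarrow>
   ('a \<Rightarrow> 'e \<Rightarrow> 'e \<Rightarrow> real) \<Rightarrow> nat \<Rightarrow> bool" where
  "semi_riemannian A g q \<longleftrightarrow>
     smooth_manifold A \<and>
     (\<forall>p. bilinear (g p) \<and> (\<forall>v w. g p v w = g p w v) \<and>
          nondegenerate_on (g p) UNIV \<and> has_index (g p) q) \<and>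
     (\<forall>X Y. vector_field A X \<and> vector_field A Y \<longrightarrow> smooth_fun A (\<lambda>p. g p (X p) (Y p)))"

definition bronze_manifold ::
  "('a::{t2_space,second_countable_topology}, 'e::euclidean_space) atlas \<Rightarrow>
   ('a \<Rightarrow> 'e \<Rightarrow> 'e \<Rightarrow> real) \<Rightarrow> nat \<Rightarrow> ('a \<Rightarrow> 'e \<Rightarrow> 'e) \<Rightarrow> bool" where
  "bronze_manifold A g q J \<longleftrightarrow>
     semi_riemannian A g q \<and> 1 \<le> q \<and> q \<le> DIM('e) - 1 \<and>
     (\<forall>p. linear (J p) \<and>
          (\<forall>v. J p (J p v) = 3 *\<^sub>R J p v + v) \<and>
          (\<forall>v w. g p (J p v) w = g p v (J p w))) \<and>
     (\<forall>X. vector_field A X \<longrightarrow> vector_field A (\<lambda>p. J p (X p)))"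

definition affine_connection ::
  "('a::{t2_space,second_countable_topology}, 'e::euclidean_space) atlas \<Rightarrow>
   (('a \<Rightarrow> 'e) \<Rightarrow> ('a \<Rightarrow> 'e) \<Rightarrow> 'a \<Rightarrow> 'e) \<Rightarrow> bool" where
  "affine_connection A D \<longleftrightarrow>
     (\<forall>X Y. vector_field A X \<and> vector_field A Y \<longrightarrow> vector_field A (D X Y)) \<and>
     (\<forall>X X' Y. vector_field A X \<and> vector_field A X' \<and> vector_field A Y \<longrightarrow>
        D (\<lambda>p. X p + X' p) Y = (\<lambda>p. D X Y p + D X' Y p)) \<and>
     (\<forall>f X Y. smooth_fun A f \<and> vector_field A X \<and> vector_field A Y \<longrightarrow>
        D (\<lambda>p. f p *\<^sub>R X p) Y = (\<lambda>p. f p *\<^sub>R D X Y p)) \<and>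
     (\<forall>X Y Y'. vector_field A X \<and> vector_field A Y \<and> vector_field A Y' \<longrightarrow>
        D X (\<lambda>p. Y p + Y' p) = (\<lambda>p. D X Y p + D X Y' p)) \<and>
     (\<forall>f X Y. smooth_fun A f \<and> vector_field A X \<and> vector_field A Y \<longrightarrow>
        D X (\<lambda>p. f p *\<^sub>R Y p) = (\<lambda>p. f p *\<^sub>R D X Y p + dir_deriv A p (X p) f *\<^sub>R Y p))"

text \<open>The Lie bracket in the torsion condition appears through its action on functions.\<close>

definition levi_civita ::
  "('a::{t2_space,second_countable_topology}, 'e::euclidean_space) atlas \<Rightarrow>
   ('a \<Rightarrow> 'e \<Rightarrow> 'e \<Rightarrow> real) \<Rightarrow> (('a \<Rightarrow> 'e) \<Rightarrow> ('a \<Rightarrow> 'e) \<Rightarrow> 'a \<Rightarrow> 'e) \<Rightarrow> bool" where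
  "levi_civita A g D \<longleftrightarrow>
     affine_connection A D \<and>
     (\<forall>X Y f p. vector_field A X \<and> vector_field A Y \<and> smooth_fun A f \<longrightarrow>
        dir_deriv A p (D X Y p - D Y X p) f =
          dir_deriv A p (X p) (\<lambda>x. dir_deriv A x (Y x) f) -
          dir_deriv A p (Y p) (\<lambda>x. dir_deriv A x (X x) f)) \<and>
     (\<forall>X Y Z p. vector_field A X \<and> vector_field A Y \<and> vector_field A Z \<longrightarrow>
        dir_deriv A p (X p) (\<lambda>x. g x (Y x) (Z x)) =
          g p (D X Y p) (Z p) + g p (Y p) (D X Z p))"

definition locally_bronze ::
  "('a::{t2_space,second_countable_topology}, 'e::euclidean_space) atlas \<Rightarrow>
   ('a \<Rightarrow> 'e \<Rightarrow> 'e \<Rightarrow> real) \<Rightarrow> nat \<Rightarrow> ('a \<Rightarrow> 'e \<Rightarrow> 'e) \<Rightarrow>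
   (('a \<Rightarrow> 'e) \<Rightarrow> ('a \<Rightarrow> 'e) \<Rightarrow> 'a \<Rightarrow> 'e) \<Rightarrow> bool" where
  "locally_bronze A g q J nab \<longleftrightarrow>
     bronze_manifold A g q J \<and> levi_civita A g nab \<and>
     (\<forall>X Y. vector_field A X \<and> vector_field A Y \<longrightarrow>
        nab X (\<lambda>p. J p (Y p)) = (\<lambda>p. J p (nab X Y p)))"

definition lm_admissible ::
  "('a::{t2_space,second_countable_topology}, 'e::euclidean_space) atlas \<Rightarrow>
   ('a \<Rightarrow> 'e \<Rightarrow> 'e \<Rightarrow> real) \<Rightarrow> ('a \<Rightarrow> real) \<Rightarrow> ('a \<Rightarrow> real) \<Rightarrow> ('a \<Rightarrow> 'e) \<Rightarrow> bool" where
  "lm_admissible A g l m \<eta> \<longleftrightarrow>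
     smooth_fun A l \<and> smooth_fun A m \<and> (l, m) \<noteq> ((\<lambda>p. 0), (\<lambda>p. 0)) \<and>
     vector_field A \<eta> \<and> (\<forall>p. g p (\<eta> p) (\<eta> p) = 1)"

definition lm_connection ::
  "('a \<Rightarrow> 'e::euclidean_space \<Rightarrow> 'e \<Rightarrow> real) \<Rightarrow> ('a \<Rightarrow> 'e \<Rightarrow> 'e) \<Rightarrow>
   (('a \<Rightarrow> 'e) \<Rightarrow> ('a \<Rightarrow> 'e) \<Rightarrow> 'a \<Rightarrow> 'e) \<Rightarrow> ('a \<Rightarrow> real) \<Rightarrow> ('a \<Rightarrow> real) \<Rightarrow> ('a \<Rightarrow> 'e) \<Rightarrow>
   ('a \<Rightarrow> 'e) \<Rightarrow> ('a \<Rightarrow> 'e) \<Rightarrow> 'a \<Rightarrow> 'e" where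
  "lm_connection g J nab l m \<eta> X Y p =
     nab X Y p + g p (Y p) (\<eta> p) *\<^sub>R (l p *\<^sub>R X p + m p *\<^sub>R J p (X p))"


section \<open>Subbundles along a submanifold\<close>

text \<open>The submanifold is a manifold in its own right (atlas C) with an injective immersion as
  inclusion. A field along it maps p to a vector tangent to the ambient manifold (atlas A)
  at the point \<open>\<iota> p\<close>.\<close>

definition submanifold ::
  "('b::{t2_space,second_countable_topology}, 'd::euclidean_space) atlas \<Rightarrow>
   ('a::{t2_space,second_countable_topology}, 'e::euclidean_space) atlas \<Rightarrow> ('b \<Rightarrow> 'a) \<Rightarrow> bool" where
  "submanifold C A \<iota> \<longleftrightarrow>
     smooth_manifold C \<and> smooth_map C A \<iota> \<and> inj \<iota> \<and> (\<forall>p. inj (pushforward C A \<iota> p))"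

definition smooth_along ::
  "('b::{t2_space,second_countable_topology}, 'd::euclidean_space) atlas \<Rightarrow>
   ('a::{t2_space,second_countable_topology}, 'e::euclidean_space) atlas \<Rightarrow> ('b \<Rightarrow> 'a) \<Rightarrow>
   'b set \<Rightarrow> ('b \<Rightarrow> 'e) \<Rightarrow> bool" where
  "smooth_along C A \<iota> U Y \<longleftrightarrow>
     (\<forall>f. smooth_fun A f \<longrightarrow> smooth_fun_on C U (\<lambda>p. dir_deriv A (\<iota> p) (Y p) f))"

definition sections ::
  "('b::{t2_space,second_countable_topology}, 'd::euclidean_space) atlas \<Rightarrow>
   ('a::{t2_space,second_countable_topology}, 'e::euclidean_space) atlas \<Rightarrow> ('b \<Rightarrow> 'a) \<Rightarrow>
   ('b \<Rightarrow> 'e set) \<Rightarrow> ('b \<Rightarrow> 'e) set" where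
  "sections C A \<iota> E = {X. (\<forall>p. X p \<in> E p) \<and> smooth_along C A \<iota> UNIV X}"

definition local_frame ::
  "('b::{t2_space,second_countable_topology}, 'd::euclidean_space) atlas \<Rightarrow>
   ('a::{t2_space,second_countable_topology}, 'e::euclidean_space) atlas \<Rightarrow> ('b \<Rightarrow> 'a) \<Rightarrow>
   nat \<Rightarrow> ('b \<Rightarrow> 'e set) \<Rightarrow> 'b set \<Rightarrow> (nat \<Rightarrow> 'b \<Rightarrow> 'e) \<Rightarrow> bool" where
  "local_frame C A \<iota> k E U s \<longleftrightarrow>
     open U \<and> (\<forall>i<k. smooth_along C A \<iota> U (s i)) \<and>
     (\<forall>p\<in>U. inj_on (\<lambda>i. s i p) {..<k} \<and> independent ((\<lambda>i. s i p) ` {..<k}) \<and>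
            span ((\<lambda>i. s i p) ` {..<k}) = E p)"

definition distribution ::
  "('b::{t2_space,second_countable_topology}, 'd::euclidean_space) atlas \<Rightarrow>
   ('a::{t2_space,second_countable_topology}, 'e::euclidean_space) atlas \<Rightarrow> ('b \<Rightarrow> 'a) \<Rightarrow>
   nat \<Rightarrow> ('b \<Rightarrow> 'e set) \<Rightarrow> bool" where
  "distribution C A \<iota> k E \<longleftrightarrow> (\<forall>p. \<exists>U s. p \<in> U \<and> local_frame C A \<iota> k E U s)"

definition orth_compl :: "('e \<Rightarrow> 'e \<Rightarrow> real) \<Rightarrow> 'e set \<Rightarrow> 'e set" where
  "orth_compl b W = {v. \<forall>w\<in>W. b v w = 0}"

definition orth_direct_sum ::
  "('e::real_vector \<Rightarrow> 'e \<Rightarrow> real) \<Rightarrow> 'e set \<Rightarrow> 'e set \<Rightarrow> 'e set \<Rightarrow> bool" where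
  "orth_direct_sum b W U V \<longleftrightarrow> W = U + V \<and> U \<inter> V = {0} \<and> (\<forall>u\<in>U. \<forall>v\<in>V. b u v = 0)"

text \<open>The value at p of an ambient connection on fields along the submanifold is computed with
  any ambient fields extending them near p; it does not depend on the
  extensions if X is tangent to the submanifold.\<close>

definition extends_near ::
  "('a::{t2_space,second_countable_topology}, 'e::euclidean_space) atlas \<Rightarrow>
   ('b::topological_space \<Rightarrow> 'a) \<Rightarrow> 'b \<Rightarrow> ('b \<Rightarrow> 'e) \<Rightarrow> ('a \<Rightarrow> 'e) \<Rightarrow> bool" where
  "extends_near A \<iota> p X X' \<longleftrightarrow> vector_field A X' \<and> (\<forall>\<^sub>F x in nhds p. X' (\<iota> x) = X x)"

definition connection_along ::
  "('a::{t2_space,second_countable_topology}, 'e::euclidean_space) atlas \<Rightarrow>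
   ('b::topological_space \<Rightarrow> 'a) \<Rightarrow> (('a \<Rightarrow> 'e) \<Rightarrow> ('a \<Rightarrow> 'e) \<Rightarrow> 'a \<Rightarrow> 'e) \<Rightarrow>
   ('b \<Rightarrow> 'e) \<Rightarrow> ('b \<Rightarrow> 'e) \<Rightarrow> 'b \<Rightarrow> 'e" where
  "connection_along A \<iota> D X Y p =
     (THE v. \<exists>X' Y'. extends_near A \<iota> p X X' \<and> extends_near A \<iota> p Y Y' \<and> v = D X' Y' (\<iota> p))"


section \<open>Lightlike submanifolds\<close>

abbreviation tangent_bundle ::
  "('b, 'd::euclidean_space) atlas \<Rightarrow> ('a, 'e::euclidean_space) atlas \<Rightarrow> ('b \<Rightarrow> 'a) \<Rightarrow> 'b \<Rightarrow> 'e set" where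
  "tangent_bundle C A \<iota> p \<equiv> range (pushforward C A \<iota> p)"

definition normal_bundle ::
  "('b, 'd::euclidean_space) atlas \<Rightarrow> ('a, 'e::euclidean_space) atlas \<Rightarrow> ('b \<Rightarrow> 'a) \<Rightarrow>
   ('a \<Rightarrow> 'e \<Rightarrow> 'e \<Rightarrow> real) \<Rightarrow> 'b \<Rightarrow> 'e set" where
  "normal_bundle C A \<iota> g p = orth_compl (g (\<iota> p)) (tangent_bundle C A \<iota> p)"

definition radical ::
  "('b, 'd::euclidean_space) atlas \<Rightarrow> ('a, 'e::euclidean_space) atlas \<Rightarrow> ('b \<Rightarrow> 'a) \<Rightarrow>
   ('a \<Rightarrow> 'e \<Rightarrow> 'e \<Rightarrow> real) \<Rightarrow> 'b \<Rightarrow> 'e set" where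
  "radical C A \<iota> g p = tangent_bundle C A \<iota> p \<inter> normal_bundle C A \<iota> g p"

definition lightlike_submanifold ::
  "('b::{t2_space,second_countable_topology}, 'd::euclidean_space) atlas \<Rightarrow>
   ('a::{t2_space,second_countable_topology}, 'e::euclidean_space) atlas \<Rightarrow> ('b \<Rightarrow> 'a) \<Rightarrow>
   ('a \<Rightarrow> 'e \<Rightarrow> 'e \<Rightarrow> real) \<Rightarrow> nat \<Rightarrow> bool" where
  "lightlike_submanifold C A \<iota> g r \<longleftrightarrow>
     submanifold C A \<iota> \<and> 0 < r \<and> distribution C A \<iota> r (radical C A \<iota> g)"

definition screen_distribution ::
  "('b::{t2_space,second_countable_topology}, 'd::euclidean_space) atlas \<Rightarrow>
   ('a::{t2_space,second_countable_topology}, 'e::euclidean_space) atlas \<Rightarrow> ('b \<Rightarrow> 'a) \<Rightarrow>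
   ('a \<Rightarrow> 'e \<Rightarrow> 'e \<Rightarrow> real) \<Rightarrow> ('b \<Rightarrow> 'e set) \<Rightarrow> bool" where
  "screen_distribution C A \<iota> g S \<longleftrightarrow>
     (\<exists>k. distribution C A \<iota> k S) \<and>
     (\<forall>p. orth_direct_sum (g (\<iota> p)) (tangent_bundle C A \<iota> p) (radical C A \<iota> g p) (S p))"

definition screen_transversal ::
  "('b::{t2_space,second_countable_topology}, 'd::euclidean_space) atlas \<Rightarrow>
   ('a::{t2_space,second_countable_topology}, 'e::euclidean_space) atlas \<Rightarrow> ('b \<Rightarrow> 'a) \<Rightarrow>
   ('a \<Rightarrow> 'e \<Rightarrow> 'e \<Rightarrow> real) \<Rightarrow> ('b \<Rightarrow> 'e set) \<Rightarrow> bool" where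
  "screen_transversal C A \<iota> g S' \<longleftrightarrow>
     (\<exists>k. distribution C A \<iota> k S') \<and>
     (\<forall>p. orth_direct_sum (g (\<iota> p)) (normal_bundle C A \<iota> g p) (radical C A \<iota> g p) (S' p))"

definition lightlike_transversal ::
  "('b::{t2_space,second_countable_topology}, 'd::euclidean_space) atlas \<Rightarrow>
   ('a::{t2_space,second_countable_topology}, 'e::euclidean_space) atlas \<Rightarrow> ('b \<Rightarrow> 'a) \<Rightarrow>
   ('a \<Rightarrow> 'e \<Rightarrow> 'e \<Rightarrow> real) \<Rightarrow> nat \<Rightarrow> ('b \<Rightarrow> 'e set) \<Rightarrow> ('b \<Rightarrow> 'e set) \<Rightarrow> ('b \<Rightarrow> 'e set) \<Rightarrow> bool" where
  "lightlike_transversal C A \<iota> g r S S' L \<longleftrightarrow>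
     (\<forall>p. \<exists>U \<xi> N. p \<in> U \<and>
        local_frame C A \<iota> r (radical C A \<iota> g) U \<xi> \<and> local_frame C A \<iota> r L U N \<and>
        (\<forall>x\<in>U. \<forall>i<r.
           N i x \<in> orth_compl (g (\<iota> x)) (S' x) \<and> N i x \<in> orth_compl (g (\<iota> x)) (S x) \<and>
           (\<forall>j<r. g (\<iota> x) (N i x) (\<xi> j x) = (if i = j then 1 else 0) \<and>
                  g (\<iota> x) (N i x) (N j x) = 0)))"

text \<open>Components with respect to a direct sum T + L + S' of subspaces.\<close>

definition split3 :: "'e::real_vector set \<Rightarrow> 'e set \<Rightarrow> 'e set \<Rightarrow> 'e \<Rightarrow> 'e \<times> 'e \<times> 'e" where
  "split3 T L S' v = (THE (a, b, c). a \<in> T \<and> b \<in> L \<and> c \<in> S' \<and> v = a + b + c)"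

definition tangential_part ::
  "('b, 'd::euclidean_space) atlas \<Rightarrow> ('a, 'e::euclidean_space) atlas \<Rightarrow> ('b \<Rightarrow> 'a) \<Rightarrow>
   ('b \<Rightarrow> 'e set) \<Rightarrow> ('b \<Rightarrow> 'e set) \<Rightarrow> ('b \<Rightarrow> 'e) \<Rightarrow> 'b \<Rightarrow> 'e" where
  "tangential_part C A \<iota> L S' Z p = fst (split3 (tangent_bundle C A \<iota> p) (L p) (S' p) (Z p))"

definition ltr_part ::
  "('b, 'd::euclidean_space) atlas \<Rightarrow> ('a, 'e::euclidean_space) atlas \<Rightarrow> ('b \<Rightarrow> 'a) \<Rightarrow>
   ('b \<Rightarrow> 'e set) \<Rightarrow> ('b \<Rightarrow> 'e set) \<Rightarrow> ('b \<Rightarrow> 'e) \<Rightarrow> 'b \<Rightarrow> 'e" where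
  "ltr_part C A \<iota> L S' Z p = fst (snd (split3 (tangent_bundle C A \<iota> p) (L p) (S' p) (Z p)))"

definition str_part ::
  "('b, 'd::euclidean_space) atlas \<Rightarrow> ('a, 'e::euclidean_space) atlas \<Rightarrow> ('b \<Rightarrow> 'a) \<Rightarrow>
   ('b \<Rightarrow> 'e set) \<Rightarrow> ('b \<Rightarrow> 'e set) \<Rightarrow> ('b \<Rightarrow> 'e) \<Rightarrow> 'b \<Rightarrow> 'e" where
  "str_part C A \<iota> L S' Z p = snd (snd (split3 (tangent_bundle C A \<iota> p) (L p) (S' p) (Z p)))"


section \<open>Screen generic lightlike submanifolds\<close>

definition B_zero :: "('b \<Rightarrow> 'a) \<Rightarrow> ('a \<Rightarrow> 'e \<Rightarrow> 'e) \<Rightarrow> ('b \<Rightarrow> 'e set) \<Rightarrow> 'b \<Rightarrow> 'e set" where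
  "B_zero \<iota> J S p = J (\<iota> p) ` S p \<inter> S p"

definition B_distr ::
  "('b, 'd::euclidean_space) atlas \<Rightarrow> ('a, 'e::euclidean_space) atlas \<Rightarrow> ('b \<Rightarrow> 'a) \<Rightarrow>
   ('a \<Rightarrow> 'e \<Rightarrow> 'e \<Rightarrow> real) \<Rightarrow> ('a \<Rightarrow> 'e \<Rightarrow> 'e) \<Rightarrow> ('b \<Rightarrow> 'e set) \<Rightarrow> 'b \<Rightarrow> 'e set" where
  "B_distr C A \<iota> g J S p = B_zero \<iota> J S p + radical C A \<iota> g p"

definition B_prime ::
  "('b \<Rightarrow> 'a) \<Rightarrow> ('a \<Rightarrow> 'e \<Rightarrow> 'e \<Rightarrow> real) \<Rightarrow> ('a \<Rightarrow> 'e \<Rightarrow> 'e) \<Rightarrow> ('b \<Rightarrow> 'e set) \<Rightarrow> 'b \<Rightarrow> 'e set" where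
  "B_prime \<iota> g J S p = S p \<inter> orth_compl (g (\<iota> p)) (B_zero \<iota> J S p)"

text \<open>Inclusions between bundles, and the equation saying that a bundle vanishes, refer to all
  fibres, and their negations accordingly to some fibre. Since \<open>B_zero\<close> is non-degenerate, the
  complement \<open>B_prime\<close> is the only orthogonal complement of it in the screen distribution S.
  L and S' are the lightlike and the screen transversal bundle.\<close>

definition screen_generic ::
  "('b::{t2_space,second_countable_topology}, 'd::euclidean_space) atlas \<Rightarrow>
   ('a::{t2_space,second_countable_topology}, 'e::euclidean_space) atlas \<Rightarrow> ('b \<Rightarrow> 'a) \<Rightarrow>
   ('a \<Rightarrow> 'e \<Rightarrow> 'e \<Rightarrow> real) \<Rightarrow> ('a \<Rightarrow> 'e \<Rightarrow> 'e) \<Rightarrow>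
   ('b \<Rightarrow> 'e set) \<Rightarrow> ('b \<Rightarrow> 'e set) \<Rightarrow> ('b \<Rightarrow> 'e set) \<Rightarrow> bool" where
  "screen_generic C A \<iota> g J S S' L \<longleftrightarrow>
     (\<forall>p. J (\<iota> p) ` radical C A \<iota> g p = radical C A \<iota> g p) \<and>
     (\<exists>k. distribution C A \<iota> k (B_zero \<iota> J S)) \<and>
     (\<forall>p. nondegenerate_on (g (\<iota> p)) (B_zero \<iota> J S p)) \<and>
     (\<exists>k. distribution C A \<iota> k (B_prime \<iota> g J S)) \<and>
     (\<forall>p. nondegenerate_on (g (\<iota> p)) (B_prime \<iota> g J S p)) \<and>
     (\<forall>p. orth_direct_sum (g (\<iota> p)) (S p) (B_zero \<iota> J S p) (B_prime \<iota> g J S p)) \<and>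
     (\<not> (\<forall>p. B_prime \<iota> g J S p = {0}) \<longrightarrow>
        \<not> (\<forall>p. J (\<iota> p) ` B_prime \<iota> g J S p \<subseteq> S p) \<and>
        \<not> (\<forall>p. J (\<iota> p) ` B_prime \<iota> g J S p \<subseteq> S' p)) \<and>
     (\<forall>Y \<in> sections C A \<iota> (B_prime \<iota> g J S).
        let JY = (\<lambda>p. J (\<iota> p) (Y p));
            fY = tangential_part C A \<iota> L S' JY;
            wY = (\<lambda>p. ltr_part C A \<iota> L S' JY p + str_part C A \<iota> L S' JY p)
        in fY \<in> sections C A \<iota> (B_prime \<iota> g J S) \<and> wY \<in> sections C A \<iota> S')"


section \<open>Induced objects\<close>

text \<open>Here \<open>Om\<close> is the restriction \<open>connection_along\<close> of the ambient connection to fields along the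
  submanifold.\<close>

definition induced_connection ::
  "('b, 'd::euclidean_space) atlas \<Rightarrow> ('a, 'e::euclidean_space) atlas \<Rightarrow> ('b \<Rightarrow> 'a) \<Rightarrow>
   ('b \<Rightarrow> 'e set) \<Rightarrow> ('b \<Rightarrow> 'e set) \<Rightarrow> (('b \<Rightarrow> 'e) \<Rightarrow> ('b \<Rightarrow> 'e) \<Rightarrow> 'b \<Rightarrow> 'e) \<Rightarrow>
   ('b \<Rightarrow> 'e) \<Rightarrow> ('b \<Rightarrow> 'e) \<Rightarrow> 'b \<Rightarrow> 'e" where
  "induced_connection C A \<iota> L S' Om X Y = tangential_part C A \<iota> L S' (Om X Y)"

definition h_l ::
  "('b, 'd::euclidean_space) atlas \<Rightarrow> ('a, 'e::euclidean_space) atlas \<Rightarrow> ('b \<Rightarrow> 'a) \<Rightarrow>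
   ('b \<Rightarrow> 'e set) \<Rightarrow> ('b \<Rightarrow> 'e set) \<Rightarrow> (('b \<Rightarrow> 'e) \<Rightarrow> ('b \<Rightarrow> 'e) \<Rightarrow> 'b \<Rightarrow> 'e) \<Rightarrow>
   ('b \<Rightarrow> 'e) \<Rightarrow> ('b \<Rightarrow> 'e) \<Rightarrow> 'b \<Rightarrow> 'e" where
  "h_l C A \<iota> L S' Om X Y = ltr_part C A \<iota> L S' (Om X Y)"

definition h_s ::
  "('b, 'd::euclidean_space) atlas \<Rightarrow> ('a, 'e::euclidean_space) atlas \<Rightarrow> ('b \<Rightarrow> 'a) \<Rightarrow>
   ('b \<Rightarrow> 'e set) \<Rightarrow> ('b \<Rightarrow> 'e set) \<Rightarrow> (('b \<Rightarrow> 'e) \<Rightarrow> ('b \<Rightarrow> 'e) \<Rightarrow> 'b \<Rightarrow> 'e) \<Rightarrow>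
   ('b \<Rightarrow> 'e) \<Rightarrow> ('b \<Rightarrow> 'e) \<Rightarrow> 'b \<Rightarrow> 'e" where
  "h_s C A \<iota> L S' Om X Y = str_part C A \<iota> L S' (Om X Y)"

text \<open>The next two conditions have the same form: the first is meant for the ambient connection
  restricted to the submanifold, the second for the induced connection.\<close>

definition totally_geodesic_foliation ::
  "('b::{t2_space,second_countable_topology}, 'd::euclidean_space) atlas \<Rightarrow>
   ('a::{t2_space,second_countable_topology}, 'e::euclidean_space) atlas \<Rightarrow> ('b \<Rightarrow> 'a) \<Rightarrow>
   (('b \<Rightarrow> 'e) \<Rightarrow> ('b \<Rightarrow> 'e) \<Rightarrow> 'b \<Rightarrow> 'e) \<Rightarrow> ('b \<Rightarrow> 'e set) \<Rightarrow> bool" where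
  "totally_geodesic_foliation C A \<iota> Om E \<longleftrightarrow>
     (\<forall>X \<in> sections C A \<iota> E. \<forall>Y \<in> sections C A \<iota> E. Om X Y \<in> sections C A \<iota> E)"

definition parallel_distribution ::
  "('b::{t2_space,second_countable_topology}, 'd::euclidean_space) atlas \<Rightarrow>
   ('a::{t2_space,second_countable_topology}, 'e::euclidean_space) atlas \<Rightarrow> ('b \<Rightarrow> 'a) \<Rightarrow>
   (('b \<Rightarrow> 'e) \<Rightarrow> ('b \<Rightarrow> 'e) \<Rightarrow> 'b \<Rightarrow> 'e) \<Rightarrow> ('b \<Rightarrow> 'e set) \<Rightarrow> bool" where
  "parallel_distribution C A \<iota> D E \<longleftrightarrow>
     (\<forall>X \<in> sections C A \<iota> E. \<forall>Y \<in> sections C A \<iota> E. D X Y \<in> sections C A \<iota> E)"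

definition distribution_geodesic ::
  "('b::{t2_space,second_countable_topology}, 'd::euclidean_space) atlas \<Rightarrow>
   ('a::{t2_space,second_countable_topology}, 'e::euclidean_space) atlas \<Rightarrow> ('b \<Rightarrow> 'a) \<Rightarrow>
   ('b \<Rightarrow> 'e set) \<Rightarrow> ('b \<Rightarrow> 'e set) \<Rightarrow> (('b \<Rightarrow> 'e) \<Rightarrow> ('b \<Rightarrow> 'e) \<Rightarrow> 'b \<Rightarrow> 'e) \<Rightarrow>
   ('b \<Rightarrow> 'e set) \<Rightarrow> bool" where
  "distribution_geodesic C A \<iota> L S' Om E \<longleftrightarrow>
     (\<forall>X \<in> sections C A \<iota> E. \<forall>Y \<in> sections C A \<iota> E. \<forall>p.
        h_l C A \<iota> L S' Om X Y p = 0 \<and> h_s C A \<iota> L S' Om X Y p = 0)"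

end

theory Submission
  imports Defs
begin

text \<open>The equivalence is fibrewise linear algebra. In a lightlike transversal bundle the duality
  \<open>g (N i) (\<xi> j) = \<delta>\<^sub>i\<^sub>j\<close> with a frame of the radical makes the sum \<open>TM + ltr(TM) + S(TM\<^sup>\<bottom>)\<close> direct,
  and \<open>dim TM + dim TM\<^sup>\<bottom> = dim\<close> (non-degeneracy of the ambient metric) shows that it exhausts the
  ambient tangent space. Hence a vector lies in \<open>B \<subseteq> TM\<close> exactly if its two transversal components
  vanish and its tangential component lies in B; in that case the ambient and the induced
  connection agree.\<close>

text \<open>Representing \<open>b\<close> by a linear map \<open>F\<close> through the Euclidean
  inner product reduces the count to the Euclidean case: non-degeneracy makes \<open>F\<close>
  bijective, and \<open>F\<close> carries the \<open>b\<close>-orthogonal complement of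
  \<open>W\<close> onto the Euclidean one.\<close>

lemma dim_orth_compl:
  fixes b :: "'e::euclidean_space \<Rightarrow> 'e \<Rightarrow> real"
  assumes "bilinear b" "nondegenerate_on b UNIV" "subspace W"
  shows "dim W + dim (orth_compl b W) = DIM('e)"
proof -
  have lin: "linear (b v)" for v
    using assms(1) by (simp add: bilinear_def)
  \<comment> \<open>The Riesz vector of the functional \<open>b v\<close>, obtained as the adjoint
    of a map into the reals applied to 1.\<close>
  define F where "F v = adjoint (b v) 1" for v
  have F: "w \<bullet> F v = b v w" for v w
    using adjoint_works[OF lin, of w v 1] by (simp add: F_def)
  have "linear F"
    by (rule linearI; rule vector_eq_ldot[THEN iffD1])
       (simp_all add: F inner_add_right bilinear_ladd[OF assms(1)] bilinear_lmul[OF assms(1)])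
  moreover have "inj F"
    \<comment> \<open>If \<open>F v\<close> vanishes, then \<open>v\<close> is
      \<open>b\<close>-orthogonal to every vector, which non-degeneracy excludes unless
      \<open>v\<close> is 0.\<close>
    unfolding linear_injective_0[OF \<open>linear F\<close>]
    by (metis F UNIV_I assms(2) inner_zero_right nondegenerate_on_def)
  ultimately have "surj F"
    by (simp add: linear_injective_imp_surjective)
  have "F ` orth_compl b W = {y \<in> UNIV. \<forall>w\<in>W. orthogonal w y}"
  proof (intro equalityI subsetI)
    fix y assume "y \<in> {y \<in> UNIV. \<forall>w\<in>W. orthogonal w y}"
    moreover obtain v where "y = F v"
      using \<open>surj F\<close> by (meson surjD)
    ultimately show "y \<in> F ` orth_compl b W"
      by (auto simp: orth_compl_def orthogonal_def F)
  qed (auto simp: orth_compl_def orthogonal_def F)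
  moreover have "dim (F ` orth_compl b W) = dim (orth_compl b W)"
    using \<open>linear F\<close> \<open>inj F\<close> by (intro dim_image_eq) (auto intro: inj_on_subset)
  moreover have "dim {y \<in> UNIV. \<forall>w\<in>W. orthogonal w y} + dim W = dim (UNIV :: 'e set)"
    using assms(3) by (intro dim_subspace_orthogonal_to_vectors) auto
  ultimately show ?thesis
    by simp
qed

lemma dim_set_plus:
  fixes U V :: "'e::euclidean_space set"
  assumes "subspace U" "subspace V" "U \<inter> V = {0}"
  shows "dim (U + V) = dim U + dim V"
proof -
  have "U + V = {x + y |x y. x \<in> U \<and> y \<in> V}"
    by (auto simp: set_plus_def)
  then show ?thesis
    using dim_sums_Int[OF assms(1,2)] assms(3) by simp
qed

lemma subspace_set_plus:
  assumes "subspace U" "subspace V"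
  shows "subspace (U + V)"
proof -
  have "U + V = {x + y |x y. x \<in> U \<and> y \<in> V}"
    by (auto simp: set_plus_def)
  then show ?thesis
    using subspace_sums[OF assms] by simp
qed

lemma distribution_subspace:
  assumes "distribution C A \<iota> k E"
  shows "subspace (E p)"
proof -
  obtain U s where "p \<in> U" "local_frame C A \<iota> k E U s"
    using assms unfolding distribution_def by meson
  then have "span ((\<lambda>i. s i p) ` {..<k}) = E p"
    unfolding local_frame_def by blast
  then show ?thesis
    by (metis subspace_span)
qed

lemma local_frame_dim:
  assumes "local_frame C A \<iota> k E U s" "p \<in> U"
  shows "dim (E p) = k"
proof -
  have "inj_on (\<lambda>i. s i p) {..<k}" "independent ((\<lambda>i. s i p) ` {..<k})"
    "span ((\<lambda>i. s i p) ` {..<k}) = E p"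
    using assms unfolding local_frame_def by blast+
  then show ?thesis
    by (metis card_image card_lessThan dim_span dim_eq_card_independent)
qed

text \<open>Injectivity of the frame at \<open>p\<close> allows a combination over the set of frame
  vectors to be rewritten as a sum over indices.\<close>

lemma local_frame_expand:
  assumes "local_frame C A \<iota> k E U s" "p \<in> U" "v \<in> E p"
  obtains c where "v = (\<Sum>i<k. c i *\<^sub>R s i p)"
proof -
  have inj: "inj_on (\<lambda>i. s i p) {..<k}" and "span ((\<lambda>i. s i p) ` {..<k}) = E p"
    using assms(1,2) unfolding local_frame_def by blast+
  then have "v \<in> span ((\<lambda>i. s i p) ` {..<k})"
    using assms(3) by simp
  then obtain u where "v = (\<Sum>x\<in>(\<lambda>i. s i p) ` {..<k}. u x *\<^sub>R x)"
    by (auto simp: span_finite)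
  then have "v = (\<Sum>i<k. u (s i p) *\<^sub>R s i p)"
    by (simp add: sum.reindex[OF inj])
  then show thesis
    by (rule that)
qed

text \<open>Expand \<open>v\<close> in the frame \<open>N\<close> of \<open>L\<close>. By duality,
  pairing with \<open>\<xi> j\<close> reads off the coefficient of \<open>N j\<close>, and this
  pairing is zero because \<open>\<xi> j\<close> is radical.\<close>

lemma lightlike_transversal_Int_orth_compl:
  assumes "lightlike_transversal C A \<iota> g r S S' L" "bilinear (g (\<iota> p))"
    and "v \<in> L p" "v \<in> orth_compl (g (\<iota> p)) (radical C A \<iota> g p)"
  shows "v = 0"
proof -
  obtain U \<xi> N where p: "p \<in> U"
    and \<xi>: "local_frame C A \<iota> r (radical C A \<iota> g) U \<xi>"
    and N: "local_frame C A \<iota> r L U N"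
    and dual: "\<forall>i<r. \<forall>j<r. g (\<iota> p) (N i p) (\<xi> j p) = (if i = j then 1 else 0)"
    using assms(1) unfolding lightlike_transversal_def by meson
  obtain c where c: "v = (\<Sum>i<r. c i *\<^sub>R N i p)"
    using local_frame_expand[OF N p assms(3)] .
  have "c j = 0" if "j < r" for j
  proof -
    have "span ((\<lambda>i. \<xi> i p) ` {..<r}) = radical C A \<iota> g p"
      using \<xi> p unfolding local_frame_def by blast
    then have "\<xi> j p \<in> radical C A \<iota> g p"
      using that span_base[of "\<xi> j p" "(\<lambda>i. \<xi> i p) ` {..<r}"] by blast
    then have "0 = g (\<iota> p) v (\<xi> j p)"
      using assms(4) by (simp add: orth_compl_def)
    also have "\<dots> = (\<Sum>i<r. c i * g (\<iota> p) (N i p) (\<xi> j p))"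
    proof -
      have "linear (\<lambda>x. g (\<iota> p) x (\<xi> j p))"
        using assms(2) by (simp add: bilinear_def)
      then show ?thesis
        by (simp add: c linear_sum[of "\<lambda>x. g (\<iota> p) x (\<xi> j p)"]
            linear_cmul[of "\<lambda>x. g (\<iota> p) x (\<xi> j p)"])
    qed
    also have "\<dots> = (\<Sum>i<r. if i = j then c i else 0)"
      using dual that by (intro sum.cong) auto
    also have "\<dots> = c j"
      using that by simp
    finally show ?thesis
      by simp
  qed
  then show ?thesis
    by (simp add: c)
qed

lemma ambient_splitting:
  fixes A :: "('a::{t2_space,second_countable_topology}, 'e::euclidean_space) atlas"
    and C :: "('b::{t2_space,second_countable_topology}, 'd::euclidean_space) atlas"
  assumes "semi_riemannian A g q" "lightlike_submanifold C A \<iota> g r"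
    "screen_distribution C A \<iota> g S" "screen_transversal C A \<iota> g S'"
    "lightlike_transversal C A \<iota> g r S S' L"
  defines "T \<equiv> \<lambda>p. tangent_bundle C A \<iota> p"
  shows "subspace (T p)" "subspace (L p)" "subspace (S' p)"
    and "(T p + S' p) \<inter> L p = {0}" "T p \<inter> S' p = {0}" "T p + S' p + L p = UNIV"
proof -
  let ?g = "g (\<iota> p)" and ?R = "radical C A \<iota> g p" and ?N = "normal_bundle C A \<iota> g p"
  have bil: "bilinear ?g" and sym: "?g v w = ?g w v" and nondeg: "nondegenerate_on ?g UNIV" for v w
    using assms(1) unfolding semi_riemannian_def by blast+
  have R: "subspace ?R"
    using assms(2) distribution_subspace unfolding lightlike_submanifold_def by blast
  have "subspace (S p)"
    using assms(3) distribution_subspace unfolding screen_distribution_def by blast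
  moreover have "T p = ?R + S p"
    using assms(3) unfolding screen_distribution_def orth_direct_sum_def T_def by blast
  ultimately show T: "subspace (T p)"
    using R subspace_set_plus by metis
  show S': "subspace (S' p)"
    using assms(4) distribution_subspace unfolding screen_transversal_def by blast
  obtain U \<xi> N where U: "p \<in> U" "local_frame C A \<iota> r (radical C A \<iota> g) U \<xi>"
    "local_frame C A \<iota> r L U N"
    using assms(5) unfolding lightlike_transversal_def by meson
  then show L: "subspace (L p)"
    unfolding local_frame_def by (metis subspace_span)
  have N: "?N = ?R + S' p" and RS': "?R \<inter> S' p = {0}"
    using assms(4) unfolding screen_transversal_def orth_direct_sum_def by blast+
  have "S' p \<subseteq> ?N"
    unfolding N using subspace_0[OF R] by (metis set_zero_plus2)
  \<comment> \<open>A tangent vector in \<open>S' p\<close> is also normal, hence radical, and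
    \<open>S' p\<close> meets the radical only in 0.\<close>
  then show TS': "T p \<inter> S' p = {0}"
    using RS' subspace_0[OF T] subspace_0[OF S'] unfolding T_def radical_def by blast
  have "T p + S' p \<subseteq> orth_compl ?g ?R"
  proof
    fix v assume "v \<in> T p + S' p"
    then obtain a c where v: "v = a + c" "a \<in> T p" "c \<in> ?N"
      using \<open>S' p \<subseteq> ?N\<close> by (auto elim!: set_plus_elim)
    \<comment> \<open>A radical vector is both normal, hence orthogonal to the tangent vector
      \<open>a\<close>, and tangent, hence orthogonal to the normal vector \<open>c\<close>.\<close>
    have "?g a w = 0" "?g c w = 0" if "w \<in> ?R" for w
      using that v sym[of a w]
      unfolding radical_def normal_bundle_def orth_compl_def T_def by auto
    then show "v \<in> orth_compl ?g ?R"
      by (simp add: v(1) orth_compl_def bilinear_ladd[OF bil])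
  qed
  then show TS'L: "(T p + S' p) \<inter> L p = {0}"
    using lightlike_transversal_Int_orth_compl[OF assms(5) bil]
      subspace_0[OF subspace_set_plus[OF T S']] subspace_0[OF L] by blast
  have "dim (T p + S' p + L p) = dim (T p) + dim (S' p) + dim (L p)"
    using T S' L TS' TS'L by (simp add: dim_set_plus subspace_set_plus)
  \<comment> \<open>Both bundles have local frames of the same length \<open>r\<close>; so
    \<open>L p\<close> can stand in for the radical, which together with \<open>S' p\<close> makes
    up the normal space.\<close>
  also have "dim (L p) = dim ?R"
    using U local_frame_dim by metis
  also have "dim (T p) + dim (S' p) + dim ?R = dim (T p) + dim ?N"
    using N RS' R S' by (simp add: dim_set_plus)
  also have "\<dots> = DIM('e)"
    using dim_orth_compl[OF bil nondeg T] by (simp add: normal_bundle_def T_def)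
  finally show "T p + S' p + L p = UNIV"
    using subspace_set_plus[OF subspace_set_plus[OF T S'] L] by (metis dim_eq_full span_eq_iff)
qed

text \<open>The definite description in \<open>split3\<close> is usable only once decompositions are
  unique. Comparing two of them puts \<open>b' - b\<close> into both \<open>T + S\<close> and
  \<open>L\<close>, so it vanishes; then \<open>a - a'\<close> lies in both \<open>T\<close> and
  \<open>S\<close>.\<close>

lemma split3_eqI:
  assumes "subspace T" "subspace L" "subspace S"
    and "(T + S) \<inter> L = {0}" "T \<inter> S = {0}"
    and "a \<in> T" "b \<in> L" "c \<in> S"
  shows "split3 T L S (a + b + c) = (a, b, c)"
  unfolding split3_def
proof (rule the_equality)
  fix t assume t: "case t of (a', b', c') \<Rightarrow> a' \<in> T \<and> b' \<in> L \<and> c' \<in> S \<and> a + b + c = a' + b' + c'"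
  obtain a' b' c' where t': "t = (a', b', c')" "a' \<in> T" "b' \<in> L" "c' \<in> S"
    and eq: "a + b + c = a' + b' + c'"
    using t by (cases t) auto
  have "b' - b = (a - a') + (c - c')"
    using eq by (simp add: algebra_simps)
  moreover have "(a - a') + (c - c') \<in> T + S"
    using assms t' by (intro set_plus_intro subspace_diff)
  moreover have "b' - b \<in> L"
    using assms t' by (intro subspace_diff)
  ultimately have "b' - b \<in> (T + S) \<inter> L"
    by simp
  then have "b' = b"
    unfolding assms(4) by simp
  have "a - a' = c' - c"
    using eq \<open>b' = b\<close> by (simp add: algebra_simps)
  moreover have "a - a' \<in> T" "c' - c \<in> S"
    using assms t' by (simp_all add: subspace_diff)
  ultimately have "a - a' \<in> T \<inter> S"
    by simp
  then have "a = a'"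
    unfolding assms(5) by simp
  then show "t = (a, b, c)"
    using t'(1) \<open>b' = b\<close> \<open>a - a' = c' - c\<close> by simp
qed (use assms in auto)

text \<open>Both summands of \<open>B_distr\<close> lie in summands of the tangent space:
  \<open>B_zero\<close> in the screen \<open>S\<close>, the radical in itself.\<close>

lemma B_distr_subset_tangent_bundle:
  assumes "screen_distribution C A \<iota> g S"
  shows "B_distr C A \<iota> g J S p \<subseteq> tangent_bundle C A \<iota> p"
proof -
  have "tangent_bundle C A \<iota> p = radical C A \<iota> g p + S p"
    using assms unfolding screen_distribution_def orth_direct_sum_def by blast
  moreover have "B_zero \<iota> J S p \<subseteq> S p"
    by (auto simp: B_zero_def)
  ultimately show ?thesis
    unfolding B_distr_def by (metis add.commute order_refl set_plus_mono2)
qed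

theorem theorem5p14:
  fixes A :: "('a::{t2_space,second_countable_topology}, 'e::euclidean_space) atlas"
    and C :: "('b::{t2_space,second_countable_topology}, 'd::euclidean_space) atlas"
    and \<iota> :: "'b \<Rightarrow> 'a"
    and g :: "'a \<Rightarrow> 'e \<Rightarrow> 'e \<Rightarrow> real" and q r :: nat
    and J :: "'a \<Rightarrow> 'e \<Rightarrow> 'e"
    and nab :: "('a \<Rightarrow> 'e) \<Rightarrow> ('a \<Rightarrow> 'e) \<Rightarrow> 'a \<Rightarrow> 'e"
    and S S' L :: "'b \<Rightarrow> 'e set"
    and l m :: "'a \<Rightarrow> real" and \<eta> :: "'a \<Rightarrow> 'e"
  assumes "locally_bronze A g q J nab"
    and "lightlike_submanifold C A \<iota> g r"
    and "screen_distribution C A \<iota> g S"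
    and "screen_transversal C A \<iota> g S'"
    and "lightlike_transversal C A \<iota> g r S S' L"
    and "screen_generic C A \<iota> g J S S' L"
    and "lm_admissible A g l m \<eta>"
  defines "Om \<equiv> connection_along A \<iota> (lm_connection g J nab l m \<eta>)"
    and "B \<equiv> B_distr C A \<iota> g J S"
  shows "totally_geodesic_foliation C A \<iota> Om B \<longleftrightarrow>
     distribution_geodesic C A \<iota> L S' Om B \<and>
     parallel_distribution C A \<iota> (induced_connection C A \<iota> L S' Om) B"
proof -
  let ?T = "\<lambda>p. tangent_bundle C A \<iota> p"
  have "semi_riemannian A g q"
    using assms(1) unfolding locally_bronze_def bronze_manifold_def by blast
  note split = ambient_splitting[OF this assms(2-5)]
  have split3: "split3 (?T p) (L p) (S' p) (a + b + c) = (a, b, c)"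
    if "a \<in> ?T p" "b \<in> L p" "c \<in> S' p" for p a b c
    using split3_eqI[OF split(1-5) that] .
  \<comment> \<open>A tangent vector decomposes as itself plus two zeros.\<close>
  have tangent: "tangential_part C A \<iota> L S' Z = Z \<and>
      (\<forall>p. ltr_part C A \<iota> L S' Z p = 0 \<and> str_part C A \<iota> L S' Z p = 0)"
    if "\<And>p. Z p \<in> ?T p" for Z
    using split3[OF that subspace_0[OF split(2)] subspace_0[OF split(3)]]
    by (auto simp: tangential_part_def ltr_part_def str_part_def)
  \<comment> \<open>Here the exhaustion of the ambient space enters: every vector has some
    decomposition, so its three parts do sum to it.\<close>
  have decomp: "Z p = tangential_part C A \<iota> L S' Z p + ltr_part C A \<iota> L S' Z p
      + str_part C A \<iota> L S' Z p" for Z p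
  proof -
    have "Z p \<in> ?T p + S' p + L p"
      using split(6) by blast
    then obtain a b c where "Z p = a + c + b" "a \<in> ?T p" "b \<in> L p" "c \<in> S' p"
      by (auto elim!: set_plus_elim)
    moreover have "a + c + b = a + b + c"
      by (simp add: algebra_simps)
    ultimately show ?thesis
      using split3 by (simp add: tangential_part_def ltr_part_def str_part_def)
  qed
  have BT: "B p \<subseteq> ?T p" for p
    unfolding B_def by (rule B_distr_subset_tangent_bundle[OF assms(3)])
  \<comment> \<open>The equivalence is shown for each single pair; the three notions quantify over
    the same pairs of sections, so it then passes through the quantifiers.\<close>
  have "Om X Y \<in> sections C A \<iota> B \<longleftrightarrow>
      (\<forall>p. h_l C A \<iota> L S' Om X Y p = 0 \<and> h_s C A \<iota> L S' Om X Y p = 0) \<and>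
      induced_connection C A \<iota> L S' Om X Y \<in> sections C A \<iota> B" (is "_ \<longleftrightarrow> ?H \<and> ?P") for X Y
  proof
    assume "Om X Y \<in> sections C A \<iota> B"
    moreover from this have "Om X Y p \<in> ?T p" for p
      using BT by (auto simp: sections_def)
    ultimately show "?H \<and> ?P"
      using tangent[of "Om X Y"] by (simp add: h_l_def h_s_def induced_connection_def)
  next
    assume H: "?H \<and> ?P"
    \<comment> \<open>The two fields coincide as functions, so smoothness is transferred along with
      membership in the fibres.\<close>
    then have "Om X Y = induced_connection C A \<iota> L S' Om X Y"
      using decomp[of "Om X Y"] by (auto simp: h_l_def h_s_def induced_connection_def)
    then show "Om X Y \<in> sections C A \<iota> B"
      using H by simp
  qed
  then show ?thesis
    unfolding totally_geodesic_foliation_def distribution_geodesic_def parallel_distribution_def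
    by blast
qed

end
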